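(* In a complex normed space $(X,\|\cdot\|)$, the following are equivalent: (i) $X$ is a complex inner product space; (ii) $\rho_\infty(x,y)=\rho_\infty(y,x)$ for all $x,y\in X$.
   Context: A complex normed space is called a complex inner product space if its norm is induced by a complex inner product. For a complex normed space $X$ and $x,y\in X$, the right norm derivative is $\rho_{+}(x,y)=\lim_{t\to0^{+}}\frac{\|x+ty\|^2-\|x\|^2}{2t}\in\mathbb{R}$, and $$\rho_{\infty}(x,y)=\frac1\pi\int_0^{2\pi}e^{i\theta}\rho_{+}(x,e^{i\theta}y)\,d\theta\in\mathbb{C}.$$
   Formalization: Condition (ii) is corrected to conjugate symmetry, ρ∞(x,y) = conj(ρ∞(y,x)) for all x,y; as printed, without the conjugate, the equivalence fails for X = ℂ, where ρ∞(1,i) = −i but ρ∞(i,1) = i. *)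

theory Defs
  imports "HOL-Analysis.Analysis"
begin

text \<open>
  The distribution has no class of complex normed spaces. The real structure inherited from
  \<^class>\<open>real_normed_vector\<close> is the restriction of the complex one (\<open>scaleR_scaleC\<close>), and its
  metric and topology are those of the norm, so the class adds nothing to the
  notion of a complex vector space with a norm.
\<close>

class complex_normed_vector = real_normed_vector +
  fixes scaleC :: "complex \<Rightarrow> 'a \<Rightarrow> 'a"  (infixr \<open>*\<^sub>C\<close> 75)
  assumes scaleC_add_right: "a *\<^sub>C (x + y) = a *\<^sub>C x + a *\<^sub>C y"
    and scaleC_add_left: "(a + b) *\<^sub>C x = a *\<^sub>C x + b *\<^sub>C x"
    and scaleC_scaleC: "a *\<^sub>C (b *\<^sub>C x) = (a * b) *\<^sub>C x"
    and scaleC_one: "1 *\<^sub>C x = x"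
    and scaleR_scaleC: "r *\<^sub>R x = complex_of_real r *\<^sub>C x"
    and norm_scaleC: "norm (a *\<^sub>C x) = cmod a * norm x"

text \<open>
  Inner products are linear in the first argument. Conjugate symmetry makes \<open>ip x x\<close> real,
  so positivity can be stated for its real part.
\<close>

definition complex_inner_product ::
    "('a::complex_normed_vector \<Rightarrow> 'a \<Rightarrow> complex) \<Rightarrow> bool" where
  "complex_inner_product ip \<longleftrightarrow>
     (\<forall>x y z. ip (x + y) z = ip x z + ip y z) \<and>
     (\<forall>a x y. ip (a *\<^sub>C x) y = a * ip x y) \<and>
     (\<forall>x y. ip y x = cnj (ip x y)) \<and>
     (\<forall>x. x \<noteq> 0 \<longrightarrow> 0 < Re (ip x x))"

definition complex_inner_product_space :: "'a::complex_normed_vector itself \<Rightarrow> bool" where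
  "complex_inner_product_space _ \<longleftrightarrow>
     (\<exists>ip :: 'a \<Rightarrow> 'a \<Rightarrow> complex.
        complex_inner_product ip \<and> (\<forall>x. norm x = sqrt (Re (ip x x))))"

text \<open>
  The limit below always exists, since \<open>t \<mapsto> (norm (x + t *\<^sub>R y))\<^sup>2\<close> is convex; and
  \<open>rho_plus x\<close> is Lipschitz, so the integrand of \<open>rho_inf\<close> is continuous.
  If the norm comes from an inner product \<open>ip\<close>, then \<open>rho_plus x y = Re (ip x y)\<close> and
  \<open>rho_inf x y = ip x y\<close>; hence \<open>rho_inf\<close> is then symmetric only up to conjugation.
\<close>

definition rho_plus :: "'a::complex_normed_vector \<Rightarrow> 'a \<Rightarrow> real" where
  "rho_plus x y =
     Lim (at_right 0) (\<lambda>t::real. ((norm (x + t *\<^sub>R y))\<^sup>2 - (norm x)\<^sup>2) / (2 * t))"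

definition rho_inf :: "'a::complex_normed_vector \<Rightarrow> 'a \<Rightarrow> complex" where
  "rho_inf x y =
     (1 / complex_of_real pi) *
     integral {0..2 * pi}
       (\<lambda>\<theta>. exp (\<i> * complex_of_real \<theta>) *
             complex_of_real (rho_plus x (exp (\<i> * complex_of_real \<theta>) *\<^sub>C y)))"

end

theory Submission
  imports Defs
begin

text \<open>
  The functional \<open>rho_inf u\<close> averages the one-sided directional derivatives at \<open>u\<close> of half the
  squared norm. It always satisfies \<open>rho_inf y (x + z *\<^sub>C y) = cnj z * (norm y)\<^sup>2 + rho_inf y x\<close>,
  so under conjugate symmetry the averaged gradient of \<open>z \<mapsto> (norm (x + z *\<^sub>C y))\<^sup>2 / 2\<close> is the
  affine function \<open>z * (norm y)\<^sup>2 + rho_inf x y\<close>. This squared norm may fail to be differentiable,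
  but it is convex, so at a point where it is touched from above by a quadratic polynomial
  it is differentiable with the same gradient as that polynomial. Subtract from it the quadratic
  with the expected gradient and \<open>\<epsilon> * (cmod z)\<^sup>2\<close>: the difference has a global maximum, and
  comparing gradients there shows that the maximum is at \<open>0\<close>. Letting \<open>\<epsilon>\<close> tend to \<open>0\<close> gives the
  expansion of \<open>(norm (x + z *\<^sub>C y))\<^sup>2\<close> with cross term \<open>2 * Re (cnj z * rho_inf x y)\<close>, from which
  \<open>rho_inf\<close> is seen to be an inner product as in the Jordan--von Neumann theorem.
\<close>

section \<open>Complex scalars and one-sided derivatives of the norm\<close>

lemma bounded_linear_scaleC_left:
  "bounded_linear (\<lambda>z. z *\<^sub>C (y::'a::complex_normed_vector))"
proof (rule bounded_linear_intro)
  fix a b :: complex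
  show "(a + b) *\<^sub>C y = a *\<^sub>C y + b *\<^sub>C y" by (rule scaleC_add_left)
  fix r :: real
  show "(r *\<^sub>R a) *\<^sub>C y = r *\<^sub>R (a *\<^sub>C y)"
    by (simp add: scaleR_scaleC scaleC_scaleC scaleR_conv_of_real)
  show "norm (a *\<^sub>C y) \<le> norm a * norm y" by (simp add: norm_scaleC)
qed

lemma scaleC_minus_left: "(- z) *\<^sub>C y = - (z *\<^sub>C (y::'a::complex_normed_vector))"
  by (rule bounded_linear.linear[OF bounded_linear_scaleC_left, THEN linear_neg])

lemma cmod_add_square: "(cmod (a + b))\<^sup>2 = (cmod a)\<^sup>2 + 2 * Re (cnj b * a) + (cmod b)\<^sup>2"
  unfolding cmod_power2 by (simp add: power2_eq_square algebra_simps)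

text \<open>Convexity of the norm along a line makes the difference quotient nondecreasing for
  positive \<open>t\<close>, and the triangle inequality bounds it below by \<open>- norm y\<close>.
  Its limit at 0 is therefore its infimum.\<close>

lemma norm_derivative_exists:
  fixes x y :: "'a::real_normed_vector"
  shows "\<exists>l. ((\<lambda>t::real. (norm (x + t *\<^sub>R y) - norm x) / t) \<longlongrightarrow> l) (at_right 0)"
proof -
  define q where "q t = (norm (x + t *\<^sub>R y) - norm x) / t" for t :: real
  have mono: "q s \<le> q t" if "0 < s" "s \<le> t" for s t
  proof -
    have "x + s *\<^sub>R y = (1 - s/t) *\<^sub>R x + (s/t) *\<^sub>R (x + t *\<^sub>R y)"
      using that by (simp add: algebra_simps)
    then have "norm (x + s *\<^sub>R y) \<le> norm ((1 - s/t) *\<^sub>R x) + norm ((s/t) *\<^sub>R (x + t *\<^sub>R y))"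
      by (metis norm_triangle_ineq)
    also have "\<dots> = (1 - s/t) * norm x + (s/t) * norm (x + t *\<^sub>R y)"
      using that by simp
    finally have "norm (x + s *\<^sub>R y) - norm x \<le> s * q t"
      unfolding q_def by (simp add: algebra_simps diff_divide_distrib)
    then show ?thesis
      using that unfolding q_def[of s] by (simp add: divide_le_eq mult.commute)
  qed
  have bdd: "bdd_below (q ` {0<..})"
  proof (rule bdd_belowI2)
    fix t :: real assume t: "t \<in> {0<..}"
    have "norm x \<le> norm (x + t *\<^sub>R y) + norm (t *\<^sub>R y)"
      by (metis add_diff_cancel norm_triangle_ineq4)
    then show "- norm y \<le> q t"
      using t unfolding q_def by (simp add: le_divide_eq algebra_simps)
  qed
  have "(q \<longlongrightarrow> Inf (q ` {0<..})) (at_right 0)"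
  proof (rule order_tendstoI)
    fix a assume "a < Inf (q ` {0<..})"
    then have "a < q t" if "0 < t" for t
      using cInf_lower[OF imageI bdd, of t] that by fastforce
    then show "\<forall>\<^sub>F t in at_right 0. a < q t"
      by (auto simp: eventually_at_filter)
  next
    fix a assume "Inf (q ` {0<..}) < a"
    then obtain b where b: "0 < b" "q b < a"
      using cInf_lessD[of "q ` {0<..}" a] by auto
    have "\<forall>\<^sub>F t in at_right 0. t \<in> {0<..<b}"
      using b(1) by (auto simp: eventually_at_right_field)
    then show "\<forall>\<^sub>F t in at_right 0. q t < a"
      by eventually_elim (use mono[of _ b] b in fastforce)
  qed
  then show ?thesis unfolding q_def by blast
qed

lemma norm_line_tendsto:
  "((\<lambda>t::real. norm (x + t *\<^sub>R y)) \<longlongrightarrow> norm (x::'a::real_normed_vector)) (at_right 0)"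
proof -
  have "((\<lambda>t::real. norm (x + t *\<^sub>R y)) \<longlongrightarrow> norm (x + 0 *\<^sub>R y)) (at_right 0)"
    by (intro tendsto_intros)
  then show ?thesis by simp
qed

text \<open>Ensures that the \<open>Lim\<close> defining \<open>rho_plus\<close> is a genuine limit:
  the difference of squares factors into the convergent quotient for the norm and the mean of two
  norms, which tends to \<open>norm x\<close>.\<close>

lemma tendsto_rho_plus:
  "((\<lambda>t::real. ((norm (x + t *\<^sub>R y))\<^sup>2 - (norm x)\<^sup>2) / (2 * t)) \<longlongrightarrow> rho_plus x y) (at_right 0)"
proof -
  obtain l where l: "((\<lambda>t::real. (norm (x + t *\<^sub>R y) - norm x) / t) \<longlongrightarrow> l) (at_right 0)"
    using norm_derivative_exists by blast
  have "((\<lambda>t::real. (norm (x + t *\<^sub>R y) - norm x) / t * ((norm (x + t *\<^sub>R y) + norm x) / 2))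
      \<longlongrightarrow> l * ((norm x + norm x) / 2)) (at_right 0)"
    by (intro tendsto_intros l norm_line_tendsto) auto
  moreover have "(\<lambda>t::real. (norm (x + t *\<^sub>R y) - norm x) / t * ((norm (x + t *\<^sub>R y) + norm x) / 2))
      = (\<lambda>t::real. ((norm (x + t *\<^sub>R y))\<^sup>2 - (norm x)\<^sup>2) / (2 * t))"
    by (rule ext) (simp add: power2_eq_square algebra_simps)
  ultimately have lim: "((\<lambda>t::real. ((norm (x + t *\<^sub>R y))\<^sup>2 - (norm x)\<^sup>2) / (2 * t))
      \<longlongrightarrow> l * ((norm x + norm x) / 2)) (at_right 0)"
    by simp
  then have "rho_plus x y = l * ((norm x + norm x) / 2)"
    unfolding rho_plus_def by (rule tendsto_Lim[OF trivial_limit_at_right_real])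
  with lim show ?thesis by (simp only:)
qed

lemma rho_plus_eqI:
  "((\<lambda>t::real. ((norm (x + t *\<^sub>R y))\<^sup>2 - (norm x)\<^sup>2) / (2 * t)) \<longlongrightarrow> l) (at_right 0)
    \<Longrightarrow> rho_plus x y = l"
  by (rule tendsto_unique[OF trivial_limit_at_right_real tendsto_rho_plus])

text \<open>One half of a Lipschitz estimate with constant \<open>norm x\<close>; exchanging
  \<open>y\<close> and \<open>y'\<close> gives the other half. It comes from factoring the
  difference of the two squared norms and bounding one factor by the triangle inequality.\<close>

lemma rho_plus_le:
  fixes x y y' :: "'a::complex_normed_vector"
  shows "rho_plus x y' \<le> rho_plus x y + norm x * norm (y' - y)"
proof (rule tendsto_le[OF trivial_limit_at_right_real _ tendsto_rho_plus])
  let ?N = "\<lambda>t::real. norm (x + t *\<^sub>R y)" and ?N' = "\<lambda>t::real. norm (x + t *\<^sub>R y')"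
  have "((\<lambda>t. ((?N t)\<^sup>2 - (norm x)\<^sup>2) / (2 * t) + (?N' t + ?N t) / 2 * norm (y' - y))
      \<longlongrightarrow> rho_plus x y + (norm x + norm x) / 2 * norm (y' - y)) (at_right 0)"
    by (intro tendsto_intros tendsto_rho_plus norm_line_tendsto) auto
  then show "((\<lambda>t. ((?N t)\<^sup>2 - (norm x)\<^sup>2) / (2 * t) + (?N' t + ?N t) / 2 * norm (y' - y))
      \<longlongrightarrow> rho_plus x y + norm x * norm (y' - y)) (at_right 0)"
    by simp
  have "((?N' t)\<^sup>2 - (norm x)\<^sup>2) / (2 * t)
      \<le> ((?N t)\<^sup>2 - (norm x)\<^sup>2) / (2 * t) + (?N' t + ?N t) / 2 * norm (y' - y)" if "0 < t" for t
  proof -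
    have "?N' t = norm ((x + t *\<^sub>R y) + t *\<^sub>R (y' - y))" by (simp add: algebra_simps)
    also have "\<dots> \<le> ?N t + norm (t *\<^sub>R (y' - y))" by (rule norm_triangle_ineq)
    finally have "?N' t \<le> ?N t + t * norm (y' - y)" using that by simp
    then have "(?N' t - ?N t) * (?N' t + ?N t) \<le> t * norm (y' - y) * (?N' t + ?N t)"
      by (intro mult_right_mono) auto
    then show ?thesis
      using that by (simp add: field_simps power2_eq_square)
  qed
  then show "\<forall>\<^sub>F t in at_right 0. ((?N' t)\<^sup>2 - (norm x)\<^sup>2) / (2 * t)
      \<le> ((?N t)\<^sup>2 - (norm x)\<^sup>2) / (2 * t) + (?N' t + ?N t) / 2 * norm (y' - y)"
    by (auto simp: eventually_at_filter)
qed

lemma continuous_on_rho_plus: "continuous_on S (rho_plus x)"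
proof -
  have "(norm x)-lipschitz_on S (rho_plus x)"
  proof (rule lipschitz_onI)
    fix y y'
    show "dist (rho_plus x y) (rho_plus x y') \<le> norm x * dist y y'"
      using rho_plus_le[of x y y'] rho_plus_le[of x y' y]
      by (simp add: dist_norm norm_minus_commute abs_le_iff)
  qed simp
  then show ?thesis by (rule lipschitz_on_continuous_on)
qed

text \<open>\<open>- rho_plus x (- y)\<close> is the left derivative of a convex function, hence at
  most the right one. The inequality comes from \<open>x\<close> being the midpoint of
  \<open>x + t *\<^sub>R y\<close> and \<open>x - t *\<^sub>R y\<close>.\<close>

lemma rho_plus_uminus_ge: "0 \<le> rho_plus x y + rho_plus x (- y)"
proof (rule tendsto_le[OF trivial_limit_at_right_real _ tendsto_const])
  let ?N = "\<lambda>t::real. norm (x + t *\<^sub>R y)" and ?N' = "\<lambda>t::real. norm (x + t *\<^sub>R (- y))"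
  show "((\<lambda>t. ((?N t)\<^sup>2 - (norm x)\<^sup>2) / (2 * t) + ((?N' t)\<^sup>2 - (norm x)\<^sup>2) / (2 * t))
      \<longlongrightarrow> rho_plus x y + rho_plus x (- y)) (at_right 0)"
    by (intro tendsto_intros tendsto_rho_plus)
  have "0 \<le> ((?N t)\<^sup>2 - (norm x)\<^sup>2) / (2 * t) + ((?N' t)\<^sup>2 - (norm x)\<^sup>2) / (2 * t)"
    if "0 < t" for t
  proof -
    have "2 *\<^sub>R x = (x + t *\<^sub>R y) + (x + t *\<^sub>R (- y))" by (simp add: scaleR_2)
    then have "2 * norm x \<le> ?N t + ?N' t"
      by (metis norm_scaleR norm_triangle_ineq abs_numeral)
    then have "(2 * norm x)\<^sup>2 \<le> (?N t + ?N' t)\<^sup>2" by (intro power_mono) auto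
    also have "\<dots> \<le> 2 * ((?N t)\<^sup>2 + (?N' t)\<^sup>2)"
      using sum_squares_bound[of "?N t" "?N' t"] by (simp add: power2_sum)
    finally have "0 \<le> ((?N t)\<^sup>2 - (norm x)\<^sup>2) + ((?N' t)\<^sup>2 - (norm x)\<^sup>2)"
      by (simp add: power_mult_distrib)
    then show ?thesis
      unfolding add_divide_distrib[symmetric] using that by (intro divide_nonneg_pos) auto
  qed
  then show "\<forall>\<^sub>F t in at_right 0.
      0 \<le> ((?N t)\<^sup>2 - (norm x)\<^sup>2) / (2 * t) + ((?N' t)\<^sup>2 - (norm x)\<^sup>2) / (2 * t)"
    by (auto simp: eventually_at_filter)
qed

text \<open>To first order in \<open>t\<close>, moving from \<open>x\<close> along
  \<open>a *\<^sub>C x + y\<close> is moving along \<open>y\<close> and then multiplying by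
  \<open>1 + t * a\<close>; the error is of order \<open>t\<^sup>2\<close>. Half the squared modulus
  of this factor has derivative \<open>Re a\<close> at 0.\<close>

lemma rho_plus_add_scaleC_self:
  fixes x y :: "'a::complex_normed_vector"
  shows "rho_plus x (a *\<^sub>C x + y) = Re a * (norm x)\<^sup>2 + rho_plus x y"
proof (rule rho_plus_eqI)
  define A where "A t = norm (x + t *\<^sub>R (a *\<^sub>C x + y))" for t :: real
  define B where "B t = cmod (1 + of_real t * a) * norm (x + t *\<^sub>R y)" for t :: real
  let ?D = "\<lambda>t. ((norm (x + t *\<^sub>R y))\<^sup>2 - (norm x)\<^sup>2) / (2 * t)"
  have diff: "\<bar>A t - B t\<bar> \<le> t\<^sup>2 * (cmod a * norm y)" for t
  proof -
    have "x + t *\<^sub>R (a *\<^sub>C x + y) - (1 + of_real t * a) *\<^sub>C (x + t *\<^sub>R y)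
        = - ((of_real (t\<^sup>2) * a) *\<^sub>C y)"
      by (simp add: scaleR_scaleC scaleC_add_left scaleC_add_right scaleC_scaleC scaleC_one
          power2_eq_square algebra_simps)
    then have "norm (x + t *\<^sub>R (a *\<^sub>C x + y) - (1 + of_real t * a) *\<^sub>C (x + t *\<^sub>R y))
        = t\<^sup>2 * (cmod a * norm y)"
      by (simp add: norm_scaleC norm_mult norm_power)
    then show ?thesis
      unfolding A_def B_def
      using norm_triangle_ineq3[of "x + t *\<^sub>R (a *\<^sub>C x + y)" "(1 + of_real t * a) *\<^sub>C (x + t *\<^sub>R y)"]
      by (simp add: norm_scaleC)
  qed
  have A: "(A \<longlongrightarrow> norm x) (at_right 0)"
    unfolding A_def by (rule norm_line_tendsto)
  have B: "(B \<longlongrightarrow> cmod (1 + of_real 0 * a) * norm x) (at_right 0)"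
    unfolding B_def by (intro tendsto_intros norm_line_tendsto)
  have small: "((\<lambda>t. (A t - B t) / t) \<longlongrightarrow> 0) (at_right 0)"
  proof (rule Lim_null_comparison)
    have "norm ((A t - B t) / t) \<le> t * (cmod a * norm y)" if "0 < t" for t
      using diff[of t] that by (simp add: divide_le_eq power2_eq_square algebra_simps)
    then show "\<forall>\<^sub>F t in at_right 0. norm ((A t - B t) / t) \<le> t * (cmod a * norm y)"
      by (auto simp: eventually_at_filter)
    have "((\<lambda>t. t * (cmod a * norm y)) \<longlongrightarrow> 0 * (cmod a * norm y)) (at_right 0)"
      by (intro tendsto_intros)
    then show "((\<lambda>t. t * (cmod a * norm y)) \<longlongrightarrow> 0) (at_right 0)" by simp
  qed
  \<comment> \<open>The first summand is the contribution of \<open>A\<^sup>2 - B\<^sup>2\<close>,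
    which vanishes in the limit; the other two come from expanding the squared modulus in
    \<open>B\<^sup>2 - (norm x)\<^sup>2\<close>.\<close>
  have lim: "((\<lambda>t. (A t - B t) / t * ((A t + B t) / 2)
        + (Re a + t / 2 * (cmod a)\<^sup>2) * (norm (x + t *\<^sub>R y))\<^sup>2 + ?D t)
      \<longlongrightarrow> 0 * ((norm x + cmod (1 + of_real 0 * a) * norm x) / 2)
        + (Re a + 0 / 2 * (cmod a)\<^sup>2) * (norm x)\<^sup>2 + rho_plus x y) (at_right 0)"
    by (intro tendsto_intros small A B norm_line_tendsto tendsto_rho_plus) auto
  have eq: "(A t - B t) / t * ((A t + B t) / 2)
        + (Re a + t / 2 * (cmod a)\<^sup>2) * (norm (x + t *\<^sub>R y))\<^sup>2 + ?D t
      = ((A t)\<^sup>2 - (norm x)\<^sup>2) / (2 * t)" if "0 < t" for t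
  proof -
    have "(cmod (1 + of_real t * a))\<^sup>2 = 1 + 2 * t * Re a + t\<^sup>2 * (cmod a)\<^sup>2"
      unfolding cmod_power2 by (simp add: power2_eq_square algebra_simps)
    then have "(B t)\<^sup>2 = (1 + 2 * t * Re a + t\<^sup>2 * (cmod a)\<^sup>2) * (norm (x + t *\<^sub>R y))\<^sup>2"
      unfolding B_def by (simp add: power_mult_distrib)
    moreover have "(A t - B t) / t * ((A t + B t) / 2) = ((A t)\<^sup>2 - (B t)\<^sup>2) / (2 * t)"
      by (simp add: power2_eq_square algebra_simps)
    ultimately show ?thesis
      using that by (simp add: field_simps power2_eq_square)
  qed
  have "((\<lambda>t. ((A t)\<^sup>2 - (norm x)\<^sup>2) / (2 * t)) \<longlongrightarrow>
      0 * ((norm x + cmod (1 + of_real 0 * a) * norm x) / 2)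
        + (Re a + 0 / 2 * (cmod a)\<^sup>2) * (norm x)\<^sup>2 + rho_plus x y) (at_right 0)"
    by (rule Lim_transform_eventually[OF lim]) (use eq in \<open>auto simp: eventually_at_filter\<close>)
  then show "((\<lambda>t. ((norm (x + t *\<^sub>R (a *\<^sub>C x + y)))\<^sup>2 - (norm x)\<^sup>2) / (2 * t))
      \<longlongrightarrow> Re a * (norm x)\<^sup>2 + rho_plus x y) (at_right 0)"
    unfolding A_def by simp
qed

section \<open>The angular average \<open>rho_inf\<close>\<close>

text \<open>Writing the real part as half the sum with the conjugate turns the integrand into a term
  oscillating as \<open>exp (2 * \<i> * \<theta>)\<close>, which integrates to 0, plus the constant
  \<open>cnj c / 2\<close>. This explains both the factor \<open>1 / pi\<close> in
  \<open>rho_inf\<close> and the conjugate.\<close>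

lemma integral_exp_Re:
  "((\<lambda>\<theta>. exp (\<i> * of_real \<theta>) * complex_of_real (Re (exp (\<i> * of_real \<theta>) * c)))
    has_integral of_real pi * cnj c) {0..2 * pi}"
proof -
  define F where "F \<theta> = exp (2 * \<i> * of_real \<theta>) * c / (4 * \<i>) + of_real \<theta> * cnj c / 2" for \<theta> :: real
  have eq: "exp (\<i> * of_real \<theta>) * complex_of_real (Re (exp (\<i> * of_real \<theta>) * c))
      = exp (2 * \<i> * of_real \<theta>) * c / 2 + cnj c / 2" for \<theta> :: real
  proof -
    have "exp (\<i> * of_real \<theta>) * cnj (exp (\<i> * of_real \<theta>)) = 1"
      by (simp add: exp_cnj flip: exp_add)
    moreover have "exp (\<i> * of_real \<theta>) * exp (\<i> * of_real \<theta>) = exp (2 * \<i> * of_real \<theta>)"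
      by (simp add: mult.assoc flip: exp_add)
    ultimately have "exp (\<i> * of_real \<theta>) * (exp (\<i> * of_real \<theta>) * c + cnj (exp (\<i> * of_real \<theta>)) * cnj c)
        = exp (2 * \<i> * of_real \<theta>) * c + cnj c"
      unfolding ring_distribs mult.assoc[symmetric] by simp
    moreover have "complex_of_real (Re (exp (\<i> * of_real \<theta>) * c))
        = (exp (\<i> * of_real \<theta>) * c + cnj (exp (\<i> * of_real \<theta>)) * cnj c) / 2"
      unfolding complex_cnj_mult[symmetric] complex_add_cnj by simp
    ultimately show ?thesis
      by (simp only: times_divide_eq_right flip: add_divide_distrib)
  qed
  have "((\<lambda>\<theta>. exp (2 * \<i> * of_real \<theta>) * c / 2 + cnj c / 2) has_integral F (2 * pi) - F 0) {0..2 * pi}"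
  proof (rule fundamental_theorem_of_calculus)
    fix \<theta> :: real
    show "(F has_vector_derivative exp (2 * \<i> * of_real \<theta>) * c / 2 + cnj c / 2) (at \<theta> within {0..2 * pi})"
      unfolding F_def by (auto intro!: derivative_eq_intros has_vector_derivative_real_field)
  qed simp
  moreover have "exp (2 * \<i> * of_real (2 * pi)) = 1"
    using exp_plus_2pin[of 0 2] by (simp add: algebra_simps)
  then have "F (2 * pi) - F 0 = of_real pi * cnj c"
    unfolding F_def by simp
  ultimately show ?thesis by (simp only: eq)
qed

text \<open>Where the directional derivatives form a real-linear functional of \<open>v\<close>, the
  average reads off its gradient: \<open>integral_exp_Re\<close> is used with
  \<open>c = cnj G\<close>, so that the two conjugations cancel.\<close>

lemma rho_inf_eqI:
  assumes "\<And>v. rho_plus x (v *\<^sub>C y) = Re (cnj v * G)"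
  shows "rho_inf x y = G"
proof -
  have "Re (cnj v * G) = Re (v * cnj G)" for v by simp
  then show ?thesis
    unfolding rho_inf_def assms using integral_unique[OF integral_exp_Re[of "cnj G"]] by simp
qed

text \<open>At every angle the multiple of the base point \<open>y\<close> splits off additively
  from \<open>rho_plus\<close>; only this real-linear part is integrated explicitly.\<close>

lemma rho_inf_add_scaleC_self:
  fixes x y :: "'a::complex_normed_vector"
  shows "rho_inf y (x + z *\<^sub>C y) = cnj z * of_real ((norm y)\<^sup>2) + rho_inf y x"
proof -
  let ?e = "\<lambda>\<theta>::real. exp (\<i> * of_real \<theta>)"
  let ?f = "\<lambda>\<theta>. ?e \<theta> * of_real (rho_plus y (?e \<theta> *\<^sub>C x))"
  \<comment> \<open>\<open>integral\<close> takes the value 0 by default on functions that are not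
    integrable, so splitting it into a sum rests on integrability, obtained here from
    continuity.\<close>
  have "continuous_on {0..2 * pi} (\<lambda>\<theta>. rho_plus y (?e \<theta> *\<^sub>C x))"
    by (rule continuous_on_compose2[OF continuous_on_rho_plus[of UNIV]])
      (auto intro!: bounded_linear.continuous_on[OF bounded_linear_scaleC_left] continuous_intros)
  then have int: "?f integrable_on {0..2 * pi}"
    by (intro integrable_continuous_interval continuous_intros)
  have "rho_plus y (?e \<theta> *\<^sub>C (x + z *\<^sub>C y)) = Re (?e \<theta> * z) * (norm y)\<^sup>2 + rho_plus y (?e \<theta> *\<^sub>C x)" for \<theta>
  proof -
    have "?e \<theta> *\<^sub>C (x + z *\<^sub>C y) = (?e \<theta> * z) *\<^sub>C y + ?e \<theta> *\<^sub>C x"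
      by (simp add: scaleC_add_right scaleC_scaleC)
    then show ?thesis by (simp only: rho_plus_add_scaleC_self)
  qed
  then have "?e \<theta> * of_real (rho_plus y (?e \<theta> *\<^sub>C (x + z *\<^sub>C y)))
      = ?e \<theta> * of_real (Re (?e \<theta> * z)) * of_real ((norm y)\<^sup>2) + ?f \<theta>" for \<theta>
    by (simp only: of_real_add of_real_mult ring_distribs mult.assoc)
  moreover have "((\<lambda>\<theta>. ?e \<theta> * of_real (Re (?e \<theta> * z)) * of_real ((norm y)\<^sup>2) + ?f \<theta>)
      has_integral of_real pi * cnj z * of_real ((norm y)\<^sup>2) + integral {0..2 * pi} ?f) {0..2 * pi}"
    by (intro has_integral_add has_integral_mult_left integral_exp_Re integrable_integral int)
  ultimately show ?thesis
    unfolding rho_inf_def by (simp add: integral_unique ring_distribs)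
qed

text \<open>The quadratic bound makes each directional derivative at most
  \<open>Re (cnj v * G)\<close>. By convexity the derivatives along \<open>v\<close> and
  \<open>- v\<close> have nonnegative sum, while their bounds cancel, so both bounds are
  attained.\<close>

lemma rho_inf_eq_if_touched_above:
  fixes u y :: "'a::complex_normed_vector"
  assumes above: "\<And>v. (norm (u + v *\<^sub>C y))\<^sup>2 \<le> (norm u)\<^sup>2 + 2 * Re (cnj v * G) + K * (cmod v)\<^sup>2"
  shows "rho_inf u y = G"
proof (rule rho_inf_eqI)
  have le: "rho_plus u (v *\<^sub>C y) \<le> Re (cnj v * G)" for v
  proof (rule tendsto_le[OF trivial_limit_at_right_real _ tendsto_rho_plus])
    have "((\<lambda>t::real. Re (cnj v * G) + t / 2 * (K * (cmod v)\<^sup>2))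
        \<longlongrightarrow> Re (cnj v * G) + 0 / 2 * (K * (cmod v)\<^sup>2)) (at_right 0)"
      by (intro tendsto_intros) auto
    then show "((\<lambda>t::real. Re (cnj v * G) + t / 2 * (K * (cmod v)\<^sup>2))
        \<longlongrightarrow> Re (cnj v * G)) (at_right 0)" by simp
    have "((norm (u + t *\<^sub>R (v *\<^sub>C y)))\<^sup>2 - (norm u)\<^sup>2) / (2 * t)
        \<le> Re (cnj v * G) + t / 2 * (K * (cmod v)\<^sup>2)" if "0 < t" for t
    proof -
      have "(norm (u + t *\<^sub>R (v *\<^sub>C y)))\<^sup>2
          \<le> (norm u)\<^sup>2 + 2 * (t * Re (cnj v * G)) + K * (t\<^sup>2 * (cmod v)\<^sup>2)"
        using above[of "of_real t * v"]
        by (simp add: scaleR_scaleC scaleC_scaleC norm_mult power_mult_distrib algebra_simps)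
      then show ?thesis
        using that by (simp add: divide_le_eq power2_eq_square algebra_simps)
    qed
    then show "\<forall>\<^sub>F t in at_right 0. ((norm (u + t *\<^sub>R (v *\<^sub>C y)))\<^sup>2 - (norm u)\<^sup>2) / (2 * t)
        \<le> Re (cnj v * G) + t / 2 * (K * (cmod v)\<^sup>2)"
      by (auto simp: eventually_at_filter)
  qed
  fix v
  have "rho_plus u (- (v *\<^sub>C y)) \<le> - Re (cnj v * G)"
    using le[of "- v"] by (simp add: scaleC_minus_left)
  then show "rho_plus u (v *\<^sub>C y) = Re (cnj v * G)"
    using le[of v] rho_plus_uminus_ge[of u "v *\<^sub>C y"] by simp
qed

section \<open>Conjugate symmetry forces a quadratic expansion of the squared norm\<close>

context
  assumes sym: "\<And>x y :: 'a::complex_normed_vector. rho_inf x y = cnj (rho_inf y x)"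
begin

text \<open>Conjugate symmetry carries the shift over to the base point, giving the averaged
  gradient at every point of the complex line through \<open>x\<close> in direction
  \<open>y\<close>.\<close>

lemma rho_inf_add_scaleC_left:
  fixes x y :: 'a
  shows "rho_inf (x + z *\<^sub>C y) y = z * of_real ((norm y)\<^sup>2) + rho_inf x y"
  using sym[of "x + z *\<^sub>C y" y] sym[of x y] by (simp add: rho_inf_add_scaleC_self)

lemma norm_expansion_le_eps:
  fixes x y :: 'a
  assumes "0 < e"
  shows "(norm (x + z *\<^sub>C y))\<^sup>2
    \<le> (norm x)\<^sup>2 + (cmod z)\<^sup>2 * (norm y)\<^sup>2 + 2 * Re (cnj z * rho_inf x y) + e * (cmod z)\<^sup>2"
proof -
  define w where "w = rho_inf x y"
  define M where "M z = (norm (x + z *\<^sub>C y))\<^sup>2 - (norm y)\<^sup>2 * (cmod z)\<^sup>2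
      - 2 * Re (cnj z * w) - e * (cmod z)\<^sup>2" for z
  \<comment> \<open>The triangle inequality gives
    \<open>M z - M 0 \<le> C * cmod z - e * (cmod z)\<^sup>2\<close>, so a maximum over the closed
    disc of radius \<open>C / e\<close> is global.\<close>
  define C where "C = 2 * (norm x * norm y) + 2 * cmod w"
  have M0: "M 0 = (norm x)\<^sup>2"
    using scaleC_add_left[of 0 0 y] unfolding M_def by simp
  have far: "M z \<le> M 0" if "C / e \<le> cmod z" for z
  proof -
    have "norm (x + z *\<^sub>C y) \<le> norm x + cmod z * norm y"
      using norm_triangle_ineq[of x "z *\<^sub>C y"] by (simp add: norm_scaleC)
    then have "(norm (x + z *\<^sub>C y))\<^sup>2 \<le> (norm x + cmod z * norm y)\<^sup>2"
      by (intro power_mono) auto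
    moreover have "- Re (cnj z * w) \<le> cmod z * cmod w"
      using abs_Re_le_cmod[of "cnj z * w"] by (simp add: norm_mult)
    moreover have "C * cmod z \<le> (e * cmod z) * cmod z"
      using that assms by (intro mult_right_mono) (auto simp: field_simps)
    ultimately show ?thesis
      unfolding M0 unfolding M_def C_def by (simp add: power2_eq_square algebra_simps)
  qed
  have "continuous_on (cball 0 (C / e)) M"
    unfolding M_def
    by (intro continuous_intros bounded_linear.continuous_on[OF bounded_linear_scaleC_left])
  moreover have "0 \<le> C / e"
    unfolding C_def using assms by simp
  ultimately obtain s where s: "s \<in> cball 0 (C / e)" "\<And>z. z \<in> cball 0 (C / e) \<Longrightarrow> M z \<le> M s"
    using continuous_attains_sup[of "cball 0 (C / e)" M] by auto
  have max: "M z \<le> M s" for z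
  proof (cases "z \<in> cball 0 (C / e)")
    case False
    then have "M z \<le> M 0" by (intro far) simp
    also have "M 0 \<le> M s" using s(2)[of 0] \<open>0 \<le> C / e\<close> by simp
    finally show ?thesis .
  qed (rule s(2))
  \<comment> \<open>Half the gradient at \<open>s\<close> of the quadratic subtracted in
    \<open>M\<close>. Maximality of \<open>M\<close> at \<open>s\<close> says that this quadratic,
    shifted by a constant, touches the squared norm from above at \<open>s\<close>.\<close>
  define G where "G = s * of_real ((norm y)\<^sup>2) + w + of_real e * s"
  have "rho_inf (x + s *\<^sub>C y) y = G"
  proof (rule rho_inf_eq_if_touched_above)
    fix v
    have "(norm ((x + s *\<^sub>C y) + v *\<^sub>C y))\<^sup>2 \<le> (norm (x + s *\<^sub>C y))\<^sup>2
        + ((norm y)\<^sup>2 + e) * ((cmod (s + v))\<^sup>2 - (cmod s)\<^sup>2) + 2 * Re (cnj v * w)"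
      using max[of "s + v"] unfolding M_def
      by (simp add: scaleC_add_left algebra_simps)
    also have "\<dots> = (norm (x + s *\<^sub>C y))\<^sup>2 + 2 * Re (cnj v * G) + ((norm y)\<^sup>2 + e) * (cmod v)\<^sup>2"
      unfolding cmod_add_square G_def by (simp add: algebra_simps)
    finally show "(norm ((x + s *\<^sub>C y) + v *\<^sub>C y))\<^sup>2
        \<le> (norm (x + s *\<^sub>C y))\<^sup>2 + 2 * Re (cnj v * G) + ((norm y)\<^sup>2 + e) * (cmod v)\<^sup>2" .
  qed
  \<comment> \<open>Symmetry gives the same averaged gradient without the term
    \<open>of_real e * s\<close>, which therefore vanishes.\<close>
  then have "s = 0"
    using assms unfolding rho_inf_add_scaleC_left G_def w_def by simp
  then show ?thesis
    using max[of z] M0 unfolding M_def w_def by (simp add: algebra_simps)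
qed

lemma norm_expansion_le:
  fixes x y :: 'a
  shows "(norm (x + z *\<^sub>C y))\<^sup>2
    \<le> (norm x)\<^sup>2 + (cmod z)\<^sup>2 * (norm y)\<^sup>2 + 2 * Re (cnj z * rho_inf x y)" (is "?l \<le> ?r")
proof (rule tendsto_lowerbound[OF _ _ trivial_limit_at_right_real])
  have "((\<lambda>e. ?r + e * (cmod z)\<^sup>2) \<longlongrightarrow> ?r + 0 * (cmod z)\<^sup>2) (at_right 0)"
    by (intro tendsto_intros)
  then show "((\<lambda>e. ?r + e * (cmod z)\<^sup>2) \<longlongrightarrow> ?r) (at_right 0)" by simp
  show "\<forall>\<^sub>F e in at_right 0. ?l \<le> ?r + e * (cmod z)\<^sup>2"
    using norm_expansion_le_eps by (auto simp: eventually_at_filter)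
qed

text \<open>The reverse inequality is the upper bound applied to the step back from
  \<open>x + z *\<^sub>C y\<close> to \<open>x\<close>, whose cross term is known from
  \<open>rho_inf_add_scaleC_left\<close>.\<close>

lemma norm_expansion:
  fixes x y :: 'a
  shows "(norm (x + z *\<^sub>C y))\<^sup>2
    = (norm x)\<^sup>2 + (cmod z)\<^sup>2 * (norm y)\<^sup>2 + 2 * Re (cnj z * rho_inf x y)"
proof (rule antisym[OF norm_expansion_le])
  have "(norm x)\<^sup>2 \<le> (norm (x + z *\<^sub>C y))\<^sup>2 + (cmod z)\<^sup>2 * (norm y)\<^sup>2
      - 2 * Re (cnj z * (z * of_real ((norm y)\<^sup>2) + rho_inf x y))"
    using norm_expansion_le[of "x + z *\<^sub>C y" "- z" y]
    by (simp add: scaleC_minus_left rho_inf_add_scaleC_left)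
  also have "Re (cnj z * (z * of_real ((norm y)\<^sup>2) + rho_inf x y))
      = (cmod z)\<^sup>2 * (norm y)\<^sup>2 + Re (cnj z * rho_inf x y)"
    unfolding cmod_power2 by (simp add: power2_eq_square algebra_simps)
  finally show "(norm x)\<^sup>2 + (cmod z)\<^sup>2 * (norm y)\<^sup>2 + 2 * Re (cnj z * rho_inf x y)
      \<le> (norm (x + z *\<^sub>C y))\<^sup>2" by (simp add: algebra_simps)
qed

section \<open>From the expansion to an inner product\<close>

text \<open>For nonzero \<open>a\<close>, pulling \<open>a\<close> out of
  \<open>a *\<^sub>C x + z *\<^sub>C y\<close> gives a second expansion of its squared norm; the
  cross terms must agree for every \<open>z\<close>.\<close>

lemma rho_inf_scaleC_left: "rho_inf (a *\<^sub>C x) (y::'a) = a * rho_inf x y"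
proof (cases "a = 0")
  case True
  have "0 *\<^sub>C x = 0" using scaleC_add_left[of 0 0 x] by simp
  moreover have "rho_inf 0 y = 0"
  proof (rule rho_inf_eq_if_touched_above[of _ _ _ "(norm y)\<^sup>2"])
    show "(norm (0 + v *\<^sub>C y))\<^sup>2 \<le> (norm (0::'a))\<^sup>2 + 2 * Re (cnj v * 0) + (norm y)\<^sup>2 * (cmod v)\<^sup>2" for v
      by (simp add: norm_scaleC power_mult_distrib)
  qed
  ultimately show ?thesis using True by simp
next
  case False
  have key: "Re (cnj z * rho_inf (a *\<^sub>C x) y) = Re (cnj z * (a * rho_inf x y))" for z
  proof -
    have "a *\<^sub>C x + z *\<^sub>C y = a *\<^sub>C (x + (z / a) *\<^sub>C y)"
      using False by (simp add: scaleC_add_right scaleC_scaleC)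
    then have "(norm (a *\<^sub>C x + z *\<^sub>C y))\<^sup>2 = (cmod a)\<^sup>2 * (norm (x + (z / a) *\<^sub>C y))\<^sup>2"
      by (simp add: norm_scaleC power_mult_distrib)
    then have "2 * Re (cnj z * rho_inf (a *\<^sub>C x) y)
        = 2 * ((cmod a)\<^sup>2 * Re (cnj (z / a) * rho_inf x y))"
      using False unfolding norm_expansion
      by (simp add: norm_scaleC norm_divide power_mult_distrib power_divide algebra_simps)
    also have "(cmod a)\<^sup>2 * Re (cnj (z / a) * rho_inf x y)
        = Re (of_real ((cmod a)\<^sup>2) * (cnj (z / a) * rho_inf x y))"
      by (simp del: of_real_power complex_cnj_divide times_divide_eq_left times_divide_eq_right)
    also have "of_real ((cmod a)\<^sup>2) * (cnj (z / a) * rho_inf x y) = cnj z * (a * rho_inf x y)"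
      unfolding complex_norm_square using False by simp
    finally show ?thesis by simp
  qed
  \<comment> \<open>Testing with 1 compares real parts, testing with \<i> compares imaginary
    parts.\<close>
  show ?thesis
    using key[of 1] key[of \<i>] by (simp add: complex_eq_iff)
qed

lemma Re_rho_inf: "2 * Re (rho_inf x (y::'a)) = (norm (x + y))\<^sup>2 - (norm x)\<^sup>2 - (norm y)\<^sup>2"
  using norm_expansion[of x 1 y] by (simp add: scaleC_one)

lemma parallelogram: "(norm (x + y))\<^sup>2 + (norm (x - (y::'a)))\<^sup>2 = 2 * (norm x)\<^sup>2 + 2 * (norm y)\<^sup>2"
  using norm_expansion[of x 1 y] norm_expansion[of x "- 1" y]
  by (simp add: scaleC_one scaleC_minus_left)

lemma Re_rho_inf_add_left: "Re (rho_inf (x + y) z) = Re (rho_inf x z) + Re (rho_inf y (z::'a))"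
proof -
  \<comment> \<open>The first two identities minus the third isolate the norm of
    \<open>x + y + z\<close>; the parallelogram law for \<open>x\<close> and \<open>y\<close> then
    eliminates the norm of \<open>x - y\<close>.\<close>
  have "(norm (x + y + z))\<^sup>2 + (norm (x + z - y))\<^sup>2 = 2 * (norm (x + z))\<^sup>2 + 2 * (norm y)\<^sup>2"
    using parallelogram[of "x + z" y] by (simp add: algebra_simps)
  moreover have "(norm (x + y + z))\<^sup>2 + (norm (y + z - x))\<^sup>2 = 2 * (norm (y + z))\<^sup>2 + 2 * (norm x)\<^sup>2"
    using parallelogram[of "y + z" x] by (simp add: algebra_simps)
  moreover have "(norm (x + z - y))\<^sup>2 + (norm (y + z - x))\<^sup>2 = 2 * (norm z)\<^sup>2 + 2 * (norm (x - y))\<^sup>2"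
    using parallelogram[of z "x - y"] by (simp add: algebra_simps)
  ultimately show ?thesis
    using parallelogram[of x y] Re_rho_inf[of "x + y" z] Re_rho_inf[of x z] Re_rho_inf[of y z]
    by linarith
qed

lemma rho_inf_add_left: "rho_inf (x + y) z = rho_inf x z + rho_inf y (z::'a)"
proof -
  have "Im (rho_inf u z) = - Re (rho_inf (\<i> *\<^sub>C u) z)" for u :: 'a
    by (simp add: rho_inf_scaleC_left)
  then show ?thesis
    by (simp add: complex_eq_iff Re_rho_inf_add_left scaleC_add_right)
qed

lemma Re_rho_inf_self: "Re (rho_inf x (x::'a)) = (norm x)\<^sup>2"
  using Re_rho_inf[of x x] by (simp add: power_mult_distrib flip: scaleR_2)

lemma complex_inner_product_rho_inf: "complex_inner_product (rho_inf :: 'a \<Rightarrow> 'a \<Rightarrow> complex)"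
  unfolding complex_inner_product_def
  by (intro conjI allI impI sym) (simp_all add: rho_inf_add_left rho_inf_scaleC_left Re_rho_inf_self)

end

section \<open>Norms induced by an inner product, and the equivalence\<close>

text \<open>Here the squared norm along the complex line is itself a quadratic polynomial, so it is
  touched from above by itself, with \<open>G = ip x y\<close>.\<close>

lemma rho_inf_eq_inner_product:
  fixes ip :: "'a::complex_normed_vector \<Rightarrow> 'a \<Rightarrow> complex"
  assumes ip: "complex_inner_product ip" and norm: "\<And>x. norm x = sqrt (Re (ip x x))"
  shows "rho_inf x y = ip x y"
proof (rule rho_inf_eq_if_touched_above[of _ _ _ "(norm y)\<^sup>2"])
  fix v
  have add: "ip (a + b) c = ip a c + ip b c" and scale: "ip (k *\<^sub>C a) b = k * ip a b"
    and cnj: "ip b a = cnj (ip a b)" for a b c k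
    using ip unfolding complex_inner_product_def by blast+
  have norm2: "(norm a)\<^sup>2 = Re (ip a a)" for a
  proof -
    \<comment> \<open>\<open>sqrt\<close> is negative on negative reals, so nonnegativity of the
      norm gives that of \<open>Re (ip a a)\<close> for all \<open>a\<close>, including 0.\<close>
    have "0 \<le> sqrt (Re (ip a a))" unfolding norm[symmetric] by simp
    then show ?thesis by (simp add: norm)
  qed
  have "ip a (b + c) = ip a b + ip a c" and "ip a (k *\<^sub>C b) = cnj k * ip a b" for a b c k
    by (metis add cnj complex_cnj_add, metis scale cnj complex_cnj_mult)
  then have "ip (x + v *\<^sub>C y) (x + v *\<^sub>C y)
      = ip x x + (cnj v * ip x y + cnj (cnj v * ip x y)) + (v * cnj v) * ip y y"
    using cnj[of y x] by (simp add: add scale algebra_simps)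
  then show "(norm (x + v *\<^sub>C y))\<^sup>2
      \<le> (norm x)\<^sup>2 + 2 * Re (cnj v * ip x y) + (norm y)\<^sup>2 * (cmod v)\<^sup>2"
    unfolding norm2 complex_norm_square[symmetric] complex_add_cnj by simp
qed

theorem theorem4p2:
  shows "complex_inner_product_space TYPE('a::complex_normed_vector) \<longleftrightarrow>
         (\<forall>x y :: 'a. rho_inf x y = cnj (rho_inf y x))"
proof
  assume "complex_inner_product_space TYPE('a)"
  then obtain ip :: "'a \<Rightarrow> 'a \<Rightarrow> complex"
    where ip: "complex_inner_product ip" "\<And>x. norm x = sqrt (Re (ip x x))"
    unfolding complex_inner_product_space_def by blast
  then have "ip x y = cnj (ip y x)" for x y
    unfolding complex_inner_product_def by blast
  then show "\<forall>x y :: 'a. rho_inf x y = cnj (rho_inf y x)"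
    unfolding rho_inf_eq_inner_product[OF ip] by blast
next
  assume "\<forall>x y :: 'a. rho_inf x y = cnj (rho_inf y x)"
  then have sym: "\<And>x y :: 'a. rho_inf x y = cnj (rho_inf y x)" by blast
  show "complex_inner_product_space TYPE('a)"
    unfolding complex_inner_product_space_def
    using complex_inner_product_rho_inf[OF sym] Re_rho_inf_self[OF sym] by (intro exI[of _ rho_inf]) simp
qed

end
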